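(* Let $G$ be either $ESL_5(\mathbb{Z})$ or $ESL_5(\mathbb{F}_p)$ with $p$ prime. The three involutions $$I_{12}=\begin{pmatrix}-1&1&0&0&0\\0&1&0&0&0\\0&0&1&0&0\\0&0&0&1&0\\0&0&0&0&1\end{pmatrix},\quad D_1=\begin{pmatrix}0&0&0&0&-1\\0&0&0&1&0\\0&0&-1&0&0\\0&1&0&0&0\\-1&0&0&0&0\end{pmatrix},\quad F_L=\begin{pmatrix}1&0&0&0&0\\0&0&0&0&1\\0&0&0&1&0\\0&0&1&0&0\\0&1&0&0&0\end{pmatrix}$$ form a minimal involutive generating set of $G$.
   Context: For a commutative ring $R$, $ESL_n(R)$ denotes the group of all $n\times n$ matrices over $R$ with determinant $1$ or $-1$. An involution is an element of order $2$. An involutive generating set is a generating set consisting of involutions; it is called minimal if no involutive generating set has fewer elements. *)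

theory Defs
  imports
    "HOL-Library.Equipollence"
    "HOL-Algebra.Multiplicative_Group"
    "HOL-Algebra.Generated_Groups"
    "Jordan_Normal_Form.Determinant"
    "Berlekamp_Zassenhaus.Finite_Field"
begin

text \<open>
  The field with \<open>p\<close> elements is \<open>'p mod_ring\<close> with \<open>'p\<close> of class \<^class>\<open>prime_card\<close>:
  its elements are the residues modulo the prime \<open>p = CARD('p)\<close>.
\<close>

definition ESL :: "'a :: comm_ring_1 itself \<Rightarrow> nat \<Rightarrow> 'a mat monoid" where
  "ESL R n = \<lparr>carrier = {A \<in> carrier_mat n n. det A = 1 \<or> det A = - 1},
              mult = (*), one = 1\<^sub>m n\<rparr>"

lemma group_ESL: "group (ESL R n)"
proof (rule groupI)
  fix A :: "'a mat" assume "A \<in> carrier (ESL R n)"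
  then have A: "A \<in> carrier_mat n n" and d: "det A = 1 \<or> det A = - 1"
    by (auto simp: ESL_def)
  define B where "B = det A \<cdot>\<^sub>m adj_mat A"
  have adj: "adj_mat A \<in> carrier_mat n n" by (rule adj_mat(1)[OF A])
  then have B: "B \<in> carrier_mat n n" by (simp add: B_def)
  have "det A * det A = 1" using d by auto
  moreover have "B * A = det A \<cdot>\<^sub>m (det A \<cdot>\<^sub>m 1\<^sub>m n)"
    unfolding B_def using mult_smult_assoc_mat[OF adj A, of "det A"] adj_mat(3)[OF A] by simp
  ultimately have BA: "B * A = 1\<^sub>m n"
    by (intro eq_matI) (simp_all flip: mult.assoc)
  have BA1: "det B * det A = 1"
    using det_mult[OF B A] BA by simp
  from d have "det B = 1 \<or> det B = - 1"
  proof
    assume "det A = - 1"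
    then have "- det B = 1" using BA1 by simp
    then have "det B = - 1" by (metis minus_minus)
    then show ?thesis ..
  qed (use BA1 in simp)
  with B BA show "\<exists>B\<in>carrier (ESL R n). B \<otimes>\<^bsub>ESL R n\<^esub> A = \<one>\<^bsub>ESL R n\<^esub>"
    by (auto simp: ESL_def)
qed (auto simp: ESL_def det_mult intro: assoc_mult_mat)

definition involution :: "('g, 'b) monoid_scheme \<Rightarrow> 'g \<Rightarrow> bool" where
  "involution G x \<longleftrightarrow> x \<in> carrier G \<and> group.ord G x = 2"

definition involutive_generating_set :: "('g, 'b) monoid_scheme \<Rightarrow> 'g set \<Rightarrow> bool" where
  "involutive_generating_set G S \<longleftrightarrow>
     (\<forall>x\<in>S. involution G x) \<and> generate G S = carrier G"

text \<open>Sizes are compared by \<open>\<prec>\<close> rather than \<^const>\<open>card\<close>, since the latter is \<open>0\<close> on infinite sets.\<close>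

definition minimal_involutive_generating_set ::
    "('g, 'b) monoid_scheme \<Rightarrow> 'g set \<Rightarrow> bool" where
  "minimal_involutive_generating_set G S \<longleftrightarrow>
     involutive_generating_set G S \<and>
     \<not> (\<exists>T. involutive_generating_set G T \<and> T \<prec> S)"

definition I12 :: "'a :: comm_ring_1 mat" where
  "I12 = mat_of_rows_list 5
    [[- 1, 1, 0, 0, 0],
     [  0, 1, 0, 0, 0],
     [  0, 0, 1, 0, 0],
     [  0, 0, 0, 1, 0],
     [  0, 0, 0, 0, 1]]"

definition D1 :: "'a :: comm_ring_1 mat" where
  "D1 = mat_of_rows_list 5
    [[  0, 0,   0, 0, - 1],
     [  0, 0,   0, 1,   0],
     [  0, 0, - 1, 0,   0],
     [  0, 1,   0, 0,   0],
     [- 1, 0,   0, 0,   0]]"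

definition FL :: "'a :: comm_ring_1 mat" where
  "FL = mat_of_rows_list 5
    [[1, 0, 0, 0, 0],
     [0, 0, 0, 0, 1],
     [0, 0, 0, 1, 0],
     [0, 0, 1, 0, 0],
     [0, 1, 0, 0, 0]]"

end

theory Submission
  imports Defs
begin

text \<open>
  The product \<open>D1 * FL\<close> is a signed permutation matrix whose permutation is a 5-cycle; its fifth
  power is \<open>- 1\<close>. A word of length 32 in the three involutions, found by a computer search, evaluates
  over every commutative ring to the transvection with entry \<open>- 1\<close> at position \<open>(0, 2)\<close>. Conjugating
  it by the powers of \<open>D1 * FL\<close> gives transvections at the positions of the cycle
  \<open>0, 2, 4, 1, 3\<close>, and commutators of these give all others. Since the integers and the prime
  fields are Euclidean and additively generated by \<open>1\<close>, transvections generate the matrices of determinant \<open>1\<close>,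
  and \<open>- 1\<close> has determinant \<open>- 1\<close> in odd dimension.

  Two involutions generate a dihedral group, in which any two squares commute; this fails in
  \<open>ESL\<close>.
\<close>

section \<open>Elimination by row additions over a Euclidean ring\<close>

text \<open>Gaussian elimination as an induction rule: the columns are cleared from left to right,
  and every row addition is undone by the premise \<open>addrow\<close>, which carries
  \<open>Q\<close> back from the simpler matrix. No swaps or scalings occur, so the determinant
  stays 1 throughout.\<close>

lemma det_1_addrow_induct [consumes 2, case_names one addrow]:
  fixes A :: "'a::euclidean_ring mat"
  assumes "A \<in> carrier_mat n n" and "det A = 1"
    and one: "Q (1\<^sub>m n)"
    and addrow: "\<And>A a i j. A \<in> carrier_mat n n \<Longrightarrow> i < n \<Longrightarrow> j < n \<Longrightarrow> i \<noteq> j \<Longrightarrow>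
      Q (addrow a i j A) \<Longrightarrow> Q A"
  shows "Q A"
proof -
  define reduced where "reduced k A \<longleftrightarrow> A \<in> carrier_mat n n \<and> det A = 1 \<and>
      (\<forall>i<n. \<forall>j<k. A $$ (i, j) = (if i = j then 1 else 0))" for k and A :: "'a mat"
  \<comment> \<open>The added row \<open>j\<close> has index at least \<open>k\<close>, so it
    vanishes in the first \<open>k\<close> columns and leaves them untouched.\<close>
  have red_addrow: "reduced k (addrow a i j A)"
    if "reduced k A" "i < n" "j < n" "k \<le> n" "i \<noteq> j" "k \<le> j" for k a i j A
    using that by (auto simp: reduced_def det_addrow)
  have column: "Q A" if r: "reduced k A" "k < n" and IH: "\<And>B. reduced (Suc k) B \<Longrightarrow> Q B" for k A
  proof -
    \<comment> \<open>With pivot 1, each row addition clears one entry above or below it; the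
      measure counts the nonzero entries that remain.\<close>
    have clear: "Q B" if "reduced k B" "B $$ (k, k) = 1" for B
      using that
    proof (induction "card {i. i < n \<and> i \<noteq> k \<and> B $$ (i, k) \<noteq> 0}" arbitrary: B rule: less_induct)
      case less
      let ?S = "\<lambda>B. {i. i < n \<and> i \<noteq> k \<and> B $$ (i, k) \<noteq> 0}"
      have Bc: "B \<in> carrier_mat n n" using less.prems by (simp add: reduced_def)
      show ?case
      proof (cases "?S B = {}")
        case True
        then have "reduced (Suc k) B"
          using less.prems by (auto simp: reduced_def less_Suc_eq)
        then show ?thesis by (rule IH)
      next
        case False
        then obtain i where i: "i < n" "i \<noteq> k" "B $$ (i, k) \<noteq> 0" by auto
        let ?C = "addrow (- B $$ (i, k)) i k B"
        have "?S ?C \<subseteq> ?S B - {i}"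
          using less.prems i Bc \<open>k < n\<close> by (auto split: if_splits)
        with i have "?S ?C \<subset> ?S B" by blast
        then have "card (?S ?C) < card (?S B)" by (intro psubset_card_mono) auto
        moreover have "?C $$ (k, k) = 1" using less.prems i Bc \<open>k < n\<close> by auto
        ultimately have "Q ?C"
          using red_addrow[OF less.prems(1), of i k] i \<open>k < n\<close> by (intro less.hyps) auto
        then show ?thesis using addrow[OF Bc] i \<open>k < n\<close> by blast
      qed
    qed
    show ?thesis
    proof (cases "Suc k < n")
      \<comment> \<open>In the last column no row is left below the pivot. The matrix is triangular
        with all other diagonal entries 1, so the determinant forces the pivot to be 1.\<close>
      case False
      then have n: "n = Suc k" using \<open>k < n\<close> by simp
      have Ac: "A \<in> carrier_mat n n" using r by (simp add: reduced_def)
      have "upper_triangular A"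
        using r n by (auto simp: reduced_def)
      then have "prod_list (diag_mat A) = 1"
        using det_upper_triangular[OF _ Ac] r by (simp add: reduced_def)
      then have "prod_list (map (\<lambda>i. A $$ (i, i)) [0..<k]) * A $$ (k, k) = 1"
        using Ac n by (simp add: diag_mat_def)
      moreover have "map (\<lambda>i. A $$ (i, i)) [0..<k] = map (\<lambda>i. 1) [0..<k]"
        using r n by (intro map_cong) (auto simp: reduced_def)
      ultimately have "A $$ (k, k) = 1" by (simp add: map_replicate_const)
      with r show ?thesis by (intro clear) auto
    next
      case True
      have below: "Q B" if B: "reduced k B" and m: "k < m" "m < n" "B $$ (m, k) dvd 1" for B m
      proof -
        obtain u where u: "B $$ (m, k) * u = 1" using m(3) by (metis dvdE)
        \<comment> \<open>Chosen so that adding this multiple of row \<open>m\<close> to row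
          \<open>k\<close> turns the pivot into 1.\<close>
        let ?a = "u * (1 - B $$ (k, k))"
        have Bc: "B \<in> carrier_mat n n" using B by (simp add: reduced_def)
        have "addrow ?a k m B $$ (k, k) = (B $$ (m, k) * u) * (1 - B $$ (k, k)) + B $$ (k, k)"
          using Bc \<open>k < n\<close> by simp
        then have "Q (addrow ?a k m B)"
          using red_addrow[OF B, of k m] u m \<open>k < n\<close> by (intro clear) auto
        then show ?thesis using addrow[OF Bc] m \<open>k < n\<close> by (metis nat_neq_iff)
      qed
      have unit: "Q B" if B: "reduced k B" and i: "k \<le> i" "i < n" "B $$ (i, k) dvd 1" for B i
      proof (cases "i = k")
        case False
        then show ?thesis using below[OF B, of i] i by simp
      next
        \<comment> \<open>A row cannot be added to itself, so a unit at the pivot is first used to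
          create a 1 in the next row, which exists since \<open>Suc k < n\<close>.\<close>
        case eq: True
        obtain u where u: "B $$ (k, k) * u = 1" using i(3) eq by (metis dvdE)
        let ?a = "u * (1 - B $$ (Suc k, k))"
        have Bc: "B \<in> carrier_mat n n" using B by (simp add: reduced_def)
        have "addrow ?a (Suc k) k B $$ (Suc k, k)
            = (B $$ (k, k) * u) * (1 - B $$ (Suc k, k)) + B $$ (Suc k, k)"
          using Bc True by simp
        then have "Q (addrow ?a (Suc k) k B)"
          using red_addrow[OF B, of "Suc k" k] u True by (intro below[of _ "Suc k"]) auto
        then show ?thesis using addrow[OF Bc] True \<open>k < n\<close> by (metis n_not_Suc_n)
      qed
      \<comment> \<open>Row \<open>k\<close> of the inverse vanishes left of column \<open>k\<close>, so it certifies that the entries of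
        column \<open>k\<close> on and below the diagonal generate the unit ideal.\<close>
      have bezout: "\<exists>c. (\<Sum>i\<in>{k..<n}. c i * B $$ (i, k)) = 1" if B: "reduced k B" for B
      proof -
        have Bc: "B \<in> carrier_mat n n" and dB: "det B = 1" using B by (auto simp: reduced_def)
        let ?C = "adj_mat B"
        have C: "?C \<in> carrier_mat n n" "?C * B = 1\<^sub>m n"
          using adj_mat[OF Bc] dB by auto
        have ent: "(\<Sum>i\<in>{0..<n}. ?C $$ (k, i) * B $$ (i, j)) = (if k = j then 1 else 0)"
          if "j < n" for j
        proof -
          have "(?C * B) $$ (k, j) = (\<Sum>i\<in>{0..<n}. ?C $$ (k, i) * B $$ (i, j))"
            using that C(1) Bc \<open>k < n\<close> by (auto simp: scalar_prod_def intro!: sum.cong)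
          then show ?thesis using C(2) that \<open>k < n\<close> by simp
        qed
        have "?C $$ (k, j) = 0" if "j < k" for j
        proof -
          have "(\<Sum>i\<in>{0..<n}. ?C $$ (k, i) * B $$ (i, j)) = (\<Sum>i\<in>{0..<n}. if i = j then ?C $$ (k, i) else 0)"
            using B that by (intro sum.cong) (auto simp: reduced_def)
          then show ?thesis using ent[of j] that \<open>k < n\<close> by simp
        qed
        then have "(\<Sum>i\<in>{0..<n}. ?C $$ (k, i) * B $$ (i, k)) = (\<Sum>i\<in>{k..<n}. ?C $$ (k, i) * B $$ (i, k))"
          by (intro sum.mono_neutral_right) auto
        with ent[of k] \<open>k < n\<close> show ?thesis by auto
      qed
      \<comment> \<open>Euclidean algorithm on the column: an entry that divides all others is a
        unit by \<open>bezout\<close>; otherwise some remainder is nonzero and smaller.\<close>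
      have euclid: "Q B" if "reduced k B" "k \<le> i" "i < n" "B $$ (i, k) \<noteq> 0" for B i
        using that
      proof (induction "euclidean_size (B $$ (i, k))" arbitrary: B i rule: less_induct)
        case less
        have Bc: "B \<in> carrier_mat n n" using less.prems by (simp add: reduced_def)
        show ?case
        proof (cases "\<forall>m\<in>{k..<n}. B $$ (i, k) dvd B $$ (m, k)")
          case True
          obtain c where c: "(\<Sum>m\<in>{k..<n}. c m * B $$ (m, k)) = 1" using bezout less.prems by blast
          have "B $$ (i, k) dvd (\<Sum>m\<in>{k..<n}. c m * B $$ (m, k))"
            using True by (intro dvd_sum) auto
          with c have "B $$ (i, k) dvd 1" by simp
          then show ?thesis using unit less.prems by blast
        next
          case False
          then obtain m where m: "k \<le> m" "m < n" "\<not> B $$ (i, k) dvd B $$ (m, k)" by auto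
          then have "m \<noteq> i" by auto
          let ?C = "addrow (- (B $$ (m, k) div B $$ (i, k))) m i B"
          have Cm: "?C $$ (m, k) = B $$ (m, k) mod B $$ (i, k)"
            using Bc m \<open>k < n\<close> by (simp add: minus_div_mult_eq_mod [symmetric])
          have "Q ?C"
          proof (rule less.hyps)
            show "euclidean_size (?C $$ (m, k)) < euclidean_size (B $$ (i, k))"
              unfolding Cm using less.prems by (intro mod_size_less)
            show "reduced k ?C"
              using less.prems m \<open>m \<noteq> i\<close> \<open>k < n\<close> by (intro red_addrow) auto
            show "?C $$ (m, k) \<noteq> 0" unfolding Cm using m by (simp add: mod_eq_0_iff_dvd)
          qed (use m in auto)
          then show ?thesis using addrow[OF Bc] m less.prems \<open>m \<noteq> i\<close> by blast
        qed
      qed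
      obtain c where c: "(\<Sum>i\<in>{k..<n}. c i * A $$ (i, k)) = 1" using bezout r by blast
      then have "\<exists>i\<in>{k..<n}. A $$ (i, k) \<noteq> 0"
        by (rule_tac ccontr) simp
      then show ?thesis using euclid[OF r(1)] by auto
    qed
  qed
  \<comment> \<open>Downward induction on \<open>k\<close>: at \<open>k = n\<close> the matrix is
    the identity, and at \<open>k = 0\<close> only determinant 1 is required.\<close>
  have "Q B" if "reduced k B" "k \<le> n" for k B
    using that(2,1)
  proof (induction k arbitrary: B rule: inc_induct)
    case base
    then have "B = 1\<^sub>m n" by (intro eq_matI) (auto simp: reduced_def)
    with one show ?case by simp
  next
    case (step m)
    then show ?case using column by blast
  qed
  from this[of 0] show ?thesis using assms(1,2) by (simp add: reduced_def)
qed

section \<open>Groups generated by two involutions\<close>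

lemma (in group) involution_iff: "involution G x \<longleftrightarrow> x \<in> carrier G \<and> x \<otimes> x = \<one> \<and> x \<noteq> \<one>"
proof (cases "x \<in> carrier G")
  case True
  have "ord x = 2 \<longleftrightarrow> x \<otimes> x = \<one> \<and> x \<noteq> \<one>"
  proof
    assume o: "ord x = 2"
    then have "x [^] (2::nat) = \<one>" using pow_ord_eq_1[OF True] by metis
    moreover have "x \<noteq> \<one>" using o by auto
    ultimately show "x \<otimes> x = \<one> \<and> x \<noteq> \<one>" using True by (simp add: numeral_2_eq_2)
  next
    assume x: "x \<otimes> x = \<one> \<and> x \<noteq> \<one>"
    then have "ord x dvd 2" using pow_eq_id[OF True, of 2] True by (simp add: numeral_2_eq_2)
    moreover have "ord x \<noteq> 1" using ord_eq_1[OF True] x by simp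
    ultimately show "ord x = 2" using prime_nat_iff two_is_prime_nat by blast
  qed
  with True show ?thesis by (simp add: involution_def)
qed (simp add: involution_def)

lemma (in group) nat_pow_intertwine:
  assumes "x \<in> carrier G" "s \<in> carrier G" "t \<in> carrier G" "x \<otimes> s = t \<otimes> x"
  shows "x \<otimes> s [^] (n::nat) = t [^] n \<otimes> x"
proof (induction n)
  case (Suc n)
  have "x \<otimes> s [^] Suc n = t [^] n \<otimes> (x \<otimes> s)"
    using Suc assms(1-3) by (simp add: m_assoc[symmetric])
  then show ?case using assms by (simp add: m_assoc)
qed (use assms in simp)

text \<open>With \<open>r = x \<otimes> y\<close>, every element is a rotation \<open>r^k\<close> or
  a reflection \<open>r^k x\<close>. Reflections square to the identity, so all squares are powers
  of \<open>r\<close>. Neither \<open>x = y\<close> nor trivial \<open>x\<close>, \<open>y\<close>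
  is excluded.\<close>

lemma (in group) squares_commute_generate_two_involutions:
  assumes x: "x \<in> carrier G" "x \<otimes> x = \<one>" and y: "y \<in> carrier G" "y \<otimes> y = \<one>"
    and g: "g \<in> generate G {x, y}" and h: "h \<in> generate G {x, y}"
  shows "(g \<otimes> g) \<otimes> (h \<otimes> h) = (h \<otimes> h) \<otimes> (g \<otimes> g)"
proof -
  define r where "r = x \<otimes> y"
  have r: "r \<in> carrier G" using x y by (simp add: r_def)
  have ix: "inv x = x" and iy: "inv y = y" using x y by (simp_all add: inv_equality)
  have ir: "inv r = y \<otimes> x" using x y by (simp add: r_def inv_mult_group ix iy)
  have y_eq: "y = inv r \<otimes> x" using x y by (simp add: ir m_assoc)
  \<comment> \<open>Conjugation by \<open>x\<close> exchanges \<open>r\<close> and its inverse; the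
    two signs of \<open>k\<close> use the two directions.\<close>
  have conj: "x \<otimes> r [^] k = r [^] (- k) \<otimes> x" for k :: int
  proof (cases k rule: int_cases2)
    case (nonneg n)
    have "x \<otimes> r = y" using x y by (simp add: r_def m_assoc[symmetric])
    then have "x \<otimes> r = inv r \<otimes> x" using y_eq by simp
    from nat_pow_intertwine[OF x(1) r _ this, of n]
    show ?thesis using r nonneg by (simp add: int_pow_neg_int int_pow_int nat_pow_inv)
  next
    case (nonpos n)
    have "x \<otimes> inv r = r \<otimes> x"
      using x y by (simp add: ir) (simp add: r_def m_assoc)
    from nat_pow_intertwine[OF x(1) _ r this, of n]
    show ?thesis using r nonpos by (simp add: int_pow_neg_int int_pow_int nat_pow_inv)
  qed
  have refl_rot: "(r [^] k \<otimes> x) \<otimes> r [^] l = r [^] (k - l) \<otimes> x" for k l :: int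
    using x r conj[of l] int_pow_mult[OF r, of k "- l"] by (simp add: m_assoc)
  have refl_refl: "(r [^] k \<otimes> x) \<otimes> (r [^] l \<otimes> x) = r [^] (k - l)" for k l :: int
  proof -
    have "(r [^] k \<otimes> x) \<otimes> (r [^] l \<otimes> x) = ((r [^] k \<otimes> x) \<otimes> r [^] l) \<otimes> x"
      using x r by (simp only: m_assoc m_closed int_pow_closed)
    then show ?thesis unfolding refl_rot using x r by (simp add: m_assoc)
  qed
  have form: "\<exists>k::int. g = r [^] k \<or> g = r [^] k \<otimes> x" if "g \<in> generate G {x, y}" for g
    using that
  proof induction
    case one
    show ?case by (rule exI[of _ 0]) simp
  next
    case (incl h)
    have "y = r [^] (-1::int) \<otimes> x" using y_eq r by (simp add: int_pow_neg)
    moreover have "x = r [^] (0::int) \<otimes> x" using x by simp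
    ultimately show ?case using incl by blast
  next
    case (inv h)
    have "y = r [^] (-1::int) \<otimes> x" using y_eq r by (simp add: int_pow_neg)
    moreover have "x = r [^] (0::int) \<otimes> x" using x by simp
    moreover have "inv h = x \<or> inv h = y" using inv ix iy by auto
    ultimately show ?case by blast
  next
    case (eng h1 h2)
    then obtain k l :: int where
      h: "h1 = r [^] k \<or> h1 = r [^] k \<otimes> x" "h2 = r [^] l \<or> h2 = r [^] l \<otimes> x" by blast
    have "r [^] k \<otimes> (r [^] l \<otimes> x) = r [^] (k + l) \<otimes> x"
      using x r by (simp add: m_assoc int_pow_mult)
    with h refl_rot[of k l] refl_refl[of k l] int_pow_mult[OF r, of k l] show ?case by metis
  qed
  have square: "\<exists>k::int. g \<otimes> g = r [^] k" if "g \<in> generate G {x, y}" for g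
    using form[OF that] refl_refl int_pow_mult[OF r] by metis
  obtain k l :: int where kl: "g \<otimes> g = r [^] k" "h \<otimes> h = r [^] l"
    using square[OF g] square[OF h] by blast
  show ?thesis unfolding kl by (simp add: int_pow_mult[OF r, symmetric] add.commute)
qed

section \<open>Transvections\<close>

lemma addrow_mat_mult_same:
  assumes "i < n" "j < n" "i \<noteq> j"
  shows "addrow_mat n a i j * addrow_mat n b i j = addrow_mat n (a + b :: 'a :: comm_ring_1) i j"
  unfolding addrow_mat[OF addrow_mat_carrier \<open>j < n\<close>, symmetric]
  using assms by (intro eq_matI) (auto simp: addrow_mat_def)

lemma addrow_mat_zero: "addrow_mat n 0 i j = (1\<^sub>m n :: 'a :: comm_ring_1 mat)"
  by (intro eq_matI) (auto simp: addrow_mat_def)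

text \<open>The Steinberg relation for the commutator of two transvections, whose inverses are
  written with negated entries. It is checked by performing the product as successive row
  additions.\<close>

lemma addrow_mat_commutator:
  fixes a b :: "'a :: comm_ring_1"
  assumes "i < n" "j < n" "k < n" "i \<noteq> j" "j \<noteq> k" "i \<noteq> k"
  shows "addrow_mat n a i j * (addrow_mat n b j k * (addrow_mat n (- a) i j * addrow_mat n (- b) j k))
    = addrow_mat n (a * b) i k"
proof -
  have "addrow a i j (addrow b j k (addrow (- a) i j (addrow_mat n (- b) j k))) = addrow_mat n (a * b) i k"
    using assms by (intro eq_matI) (auto simp: addrow_mat_def algebra_simps)
  then show ?thesis using assms by (simp add: addrow_mat[symmetric, of _ n n])
qed

lemma addrow_uminus_addrow:
  assumes "A \<in> carrier_mat n n" "i < n" "j < n" "i \<noteq> j"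
  shows "addrow_mat n (- a) i j * addrow a i j A = (A :: 'a :: comm_ring_1 mat)"
  unfolding addrow_mat[OF addrow_carrier[THEN iffD2, OF assms(1)] \<open>j < n\<close>, symmetric]
  using assms by (intro eq_matI) auto

lemma Ex_carrier_ESL_squares_not_commute:
  assumes "3 \<le> n"
  shows "\<exists>A\<in>carrier (ESL TYPE('a :: comm_ring_1) n). \<exists>B\<in>carrier (ESL TYPE('a) n).
    (A * A) * (B * B) \<noteq> (B * B) * (A * A)"
proof -
  \<comment> \<open>Plain transvections would fail in characteristic 2, where their squares are
    trivial. This product has the block with rows 0, 1 and -1, 1, whose square has order 3 over
    every ring; \<open>B\<close> is the same block one index further.\<close>
  define A :: "'a mat" where "A = addrow_mat n 1 0 1 * addrow_mat n (- 1) 1 0"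
  define B :: "'a mat" where "B = addrow_mat n 1 1 2 * addrow_mat n (- 1) 2 1"
  have C: "A \<in> carrier_mat n n" "B \<in> carrier_mat n n"
    by (auto simp: A_def B_def intro!: mult_carrier_mat)
  have "det A = 1" "det B = 1"
    by (simp_all add: A_def B_def det_mult[of _ n] det_addrow_mat)
  with C have ESL: "A \<in> carrier (ESL TYPE('a) n)" "B \<in> carrier (ESL TYPE('a) n)"
    by (auto simp: ESL_def)
  have A_act: "A * X = addrow 1 0 1 (addrow (- 1) 1 0 X)" if "X \<in> carrier_mat n n" for X
    using that assms by (simp add: A_def assoc_mult_mat[of _ n n _ n _ n])
      (simp add: addrow_mat[symmetric, of _ n n])
  have B_act: "B * X = addrow 1 1 2 (addrow (- 1) 2 1 X)" if "X \<in> carrier_mat n n" for X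
    using that assms by (simp add: B_def assoc_mult_mat[of _ n n _ n _ n])
      (simp add: addrow_mat[symmetric, of _ n n])
  have "(A * A) * (B * B) = A * (A * (B * (B * 1\<^sub>m n)))"
    "(B * B) * (A * A) = B * (B * (A * (A * 1\<^sub>m n)))"
    using C by (simp_all add: assoc_mult_mat[of _ n n _ n _ n])
  \<comment> \<open>\<open>A * A\<close> has entry 1 at \<open>(0, 1)\<close> and
    \<open>B * B\<close> has entry 1 at \<open>(1, 2)\<close>, which gives 1 in the first order; row
    0 of \<open>B * B\<close> is that of the identity, which gives 0 in the other.\<close>
  then have "((A * A) * (B * B)) $$ (0, 2) = 1" "((B * B) * (A * A)) $$ (0, 2) = 0"
    using assms by (simp_all add: A_act B_act)
  then have "(A * A) * (B * B) \<noteq> (B * B) * (A * A)" by force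
  with ESL show ?thesis by blast
qed

section \<open>Evaluating words in the three generators\<close>

abbreviation mat5 :: "'a list list \<Rightarrow> 'a mat" where
  "mat5 \<equiv> mat_of_rows_list 5"

lemma mat5_carrier: "length rs = 5 \<Longrightarrow> mat5 rs \<in> carrier_mat 5 5"
  by (simp add: mat_of_rows_list_def)

lemma eq_mat5I:
  assumes "dim_row A = 5" "dim_col A = 5" "dim_row B = 5" "dim_col B = 5"
    and "\<forall>i\<in>{0,1,2,3,4}. \<forall>j\<in>{0,1,2,3,4}. A $$ (i, j) = B $$ (i, j)"
  shows "A = B"
proof (rule eq_matI)
  fix i j assume "i < dim_row B" "j < dim_col B"
  then have "i \<in> {0,1,2,3,4}" "j \<in> {0,1,2,3,4}" using assms(3,4) by auto
  then show "A $$ (i, j) = B $$ (i, j)" using assms(5) by blast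
qed (use assms in auto)

lemma gen_carrier [simp]:
  "I12 \<in> carrier_mat 5 5" "D1 \<in> carrier_mat 5 5" "FL \<in> carrier_mat 5 5"
  by (simp_all add: I12_def D1_def FL_def mat5_carrier)

context
  fixes a0 a1 a2 a3 a4 b0 b1 b2 b3 b4 c0 c1 c2 c3 c4 d0 d1 d2 d3 d4 e0 e1 e2 e3 e4 :: "'a :: comm_ring_1"
begin

text \<open>This rule and the next two let the simplifier evaluate a word letter by letter on
  explicit rows, over an arbitrary commutative ring.\<close>

lemma I12_times:
  "I12 * mat5 [[a0,a1,a2,a3,a4],[b0,b1,b2,b3,b4],[c0,c1,c2,c3,c4],[d0,d1,d2,d3,d4],[e0,e1,e2,e3,e4]] =
   mat5 [[b0-a0,b1-a1,b2-a2,b3-a3,b4-a4],[b0,b1,b2,b3,b4],[c0,c1,c2,c3,c4],[d0,d1,d2,d3,d4],[e0,e1,e2,e3,e4]]"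
  by (rule eq_mat5I) (simp_all add: I12_def mat_of_rows_list_def scalar_prod_def eval_nat_numeral)

lemma D1_times:
  "D1 * mat5 [[a0,a1,a2,a3,a4],[b0,b1,b2,b3,b4],[c0,c1,c2,c3,c4],[d0,d1,d2,d3,d4],[e0,e1,e2,e3,e4]] =
   mat5 [[-e0,-e1,-e2,-e3,-e4],[d0,d1,d2,d3,d4],[-c0,-c1,-c2,-c3,-c4],[b0,b1,b2,b3,b4],[-a0,-a1,-a2,-a3,-a4]]"
  by (rule eq_mat5I) (simp_all add: D1_def mat_of_rows_list_def scalar_prod_def eval_nat_numeral)

lemma FL_times:
  "FL * mat5 [[a0,a1,a2,a3,a4],[b0,b1,b2,b3,b4],[c0,c1,c2,c3,c4],[d0,d1,d2,d3,d4],[e0,e1,e2,e3,e4]] =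
   mat5 [[a0,a1,a2,a3,a4],[e0,e1,e2,e3,e4],[d0,d1,d2,d3,d4],[c0,c1,c2,c3,c4],[b0,b1,b2,b3,b4]]"
  by (rule eq_mat5I) (simp_all add: FL_def mat_of_rows_list_def scalar_prod_def eval_nat_numeral)

end

lemma one_mat5:
  "1\<^sub>m 5 = mat5 [[1,0,0,0,0],[0,1,0,0,0],[0,0,1,0,0],[0,0,0,1,0],[0,0,0,0,1 :: 'a :: comm_ring_1]]"
  by (rule eq_mat5I) (simp_all add: mat_of_rows_list_def addrow_mat_def eval_nat_numeral)

lemma uminus_one_mat5:
  "- mat5 [[1,0,0,0,0],[0,1,0,0,0],[0,0,1,0,0],[0,0,0,1,0],[0,0,0,0,1]] =
    mat5 [[-1,0,0,0,0],[0,-1,0,0,0],[0,0,-1,0,0],[0,0,0,-1,0],[0,0,0,0,-1 :: 'a :: comm_ring_1]]"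
  by (rule eq_mat5I) (simp_all add: mat_of_rows_list_def eval_nat_numeral)

lemmas gen_times = I12_times D1_times FL_times

lemma addrow_mat5:
  "addrow_mat 5 a i j = mat5 (map (\<lambda>k. map (\<lambda>l.
    if k = i \<and> l = j then a + (if k = l then 1 else 0) else if k = l then 1 else 0) [0..<5]) [0..<5])"
  by (rule eq_mat5I) (simp_all add: mat_of_rows_list_def addrow_mat_def eval_nat_numeral)

text \<open>Kept as a list of letters: \<open>word_mat\<close> evaluates it from the right, and
  membership in the generated subgroup follows by induction on the list.\<close>

definition transvection_word :: "'a :: comm_ring_1 mat list" where
  "transvection_word =
    [FL, I12, D1, FL, D1, I12, D1, FL, I12, D1, FL, I12, FL, D1, I12, FL,
     D1, I12, D1, FL, D1, FL, D1, I12, D1, FL, I12, FL, D1, I12, D1, I12]"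

abbreviation word_mat :: "'a :: comm_ring_1 mat list \<Rightarrow> 'a mat" where
  "word_mat w \<equiv> foldr (*) w (1\<^sub>m 5)"

text \<open>The word \<open>s\<close> is inverse to \<open>r\<close>. Conjugation by
  \<open>r\<close> lowers both indices by 1 modulo 5 and multiplies the entry by the signs that
  \<open>r\<close> attaches to the two basis vectors, hence the varying signs.\<close>

lemma word_mat_transvection:
  fixes r s :: "'a :: comm_ring_1 mat list" and w :: "'a mat list"
  defines "r \<equiv> [D1, FL]" and "s \<equiv> [FL, D1]" and "w \<equiv> transvection_word"
  shows "word_mat w = addrow_mat 5 (- 1) 0 2"
    and "word_mat (r @ w @ s) = addrow_mat 5 1 4 1"
    and "word_mat (r @ r @ w @ s @ s) = addrow_mat 5 (- 1) 3 0"
    and "word_mat (r @ r @ r @ w @ s @ s @ s) = addrow_mat 5 (- 1) 2 4"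
    and "word_mat (r @ r @ r @ r @ w @ s @ s @ s @ s) = addrow_mat 5 (- 1) 1 3"
    and "word_mat (r @ r @ r @ r @ r) = - 1\<^sub>m 5"
  by (simp_all add: r_def s_def w_def transvection_word_def one_mat5 uminus_one_mat5 gen_times
      addrow_mat5 upt_rec[of _ 5])

lemma gen_mult_self:
  "I12 * I12 = (1\<^sub>m 5 :: 'a :: comm_ring_1 mat)"
  "D1 * D1 = (1\<^sub>m 5 :: 'a mat)"
  "FL * FL = (1\<^sub>m 5 :: 'a mat)"
proof -
  have "I12 * (I12 * 1\<^sub>m 5) = (1\<^sub>m 5 :: 'a mat)" "D1 * (D1 * 1\<^sub>m 5) = (1\<^sub>m 5 :: 'a mat)"
    "FL * (FL * 1\<^sub>m 5) = (1\<^sub>m 5 :: 'a mat)"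
    by (simp_all add: one_mat5 gen_times)
  then show "I12 * I12 = (1\<^sub>m 5 :: 'a mat)" "D1 * D1 = (1\<^sub>m 5 :: 'a mat)"
    "FL * FL = (1\<^sub>m 5 :: 'a mat)"
    by (simp_all add: right_mult_one_mat[of _ 5])
qed

lemma gen_entries:
  "I12 $$ (0, 0) = (- 1 :: 'a :: comm_ring_1)" "I12 $$ (0, 1) = (1 :: 'a)"
  "D1 $$ (0, 0) = (0 :: 'a)" "D1 $$ (0, 1) = (0 :: 'a)"
  "FL $$ (0, 0) = (1 :: 'a)" "FL $$ (0, 1) = (0 :: 'a)" "FL $$ (1, 1) = (0 :: 'a)"
  by (simp_all add: I12_def D1_def FL_def mat_of_rows_list_def)

text \<open>Since 1 and -1 coincide in characteristic 2, each pair is separated at a position where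
  one matrix has 0 and the other 1.\<close>

lemma gen_distinct:
  "distinct [I12, D1, FL, 1\<^sub>m 5 :: 'a :: comm_ring_1 mat]"
proof -
  have "I12 \<noteq> (D1 :: 'a mat)" "I12 \<noteq> (FL :: 'a mat)" "D1 \<noteq> (FL :: 'a mat)"
    by (metis gen_entries zero_neq_one)+
  moreover have "I12 \<noteq> (1\<^sub>m 5 :: 'a mat)" "D1 \<noteq> (1\<^sub>m 5 :: 'a mat)" "FL \<noteq> (1\<^sub>m 5 :: 'a mat)"
    using gen_entries[where 'a = 'a]
    by (auto dest: arg_cong[of _ _ "\<lambda>A. A $$ (0, 1)"] arg_cong[of _ _ "\<lambda>A. A $$ (0, 0)"]
        arg_cong[of _ _ "\<lambda>A. A $$ (1, 1)"])
  ultimately show ?thesis by simp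
qed

section \<open>Two involutions do not suffice\<close>

lemma ESL_simps [simp]:
  "A \<otimes>\<^bsub>ESL R n\<^esub> B = A * B" "\<one>\<^bsub>ESL R n\<^esub> = 1\<^sub>m n"
  by (simp_all add: ESL_def)

lemma ESL_carrier_iff:
  "A \<in> carrier (ESL R n) \<longleftrightarrow> A \<in> carrier_mat n n \<and> (det A = 1 \<or> det A = - 1)"
  by (simp add: ESL_def)

lemma ESL_not_generated_by_two_involutions:
  fixes X Y :: "'a :: comm_ring_1 mat"
  assumes "3 \<le> n" "involution (ESL TYPE('a) n) X" "involution (ESL TYPE('a) n) Y"
  shows "generate (ESL TYPE('a) n) {X, Y} \<noteq> carrier (ESL TYPE('a) n)"
proof
  interpret group "ESL TYPE('a) n" by (rule group_ESL)
  assume eq: "generate (ESL TYPE('a) n) {X, Y} = carrier (ESL TYPE('a) n)"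
  obtain A B where "A \<in> carrier (ESL TYPE('a) n)" "B \<in> carrier (ESL TYPE('a) n)"
    "(A * A) * (B * B) \<noteq> (B * B) * (A * A)"
    using Ex_carrier_ESL_squares_not_commute[OF assms(1)] by blast
  then show False
    using squares_commute_generate_two_involutions[of X Y A B] assms(2,3) eq
    by (simp add: involution_iff)
qed

text \<open>A smaller set has at most two elements and can be padded to a pair of possibly equal
  involutions; \<open>x0\<close> serves when it is empty.\<close>

lemma involutive_generating_set_not_lesspoll_3:
  assumes "group G" and x0: "involution G x0"
    and two: "\<And>x y. involution G x \<Longrightarrow> involution G y \<Longrightarrow> generate G {x, y} \<noteq> carrier G"
    and T: "involutive_generating_set G T" "T \<prec> S" and S: "card S = 3"
  shows False
proof -
  interpret group G by fact
  have "finite S" using S by (intro card_ge_0_finite) simp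
  then have "S \<approx> {..<3::nat}" using S by (simp add: eqpoll_iff_finite_card)
  with T(2) have "T \<prec> {..<3::nat}" by (rule lesspoll_eq_trans)
  then have fin: "finite T" "card T < 3" by (simp_all add: lesspoll_iff_finite_card)
  obtain x y where xy: "T \<subseteq> {x, y}" "involution G x" "involution G y"
  proof -
    consider "card T = 0" | "card T = 1" | "card T = 2" using fin(2) by linarith
    then show ?thesis
    proof cases
      case 1
      with fin that[of x0 x0] x0 show ?thesis by simp
    next
      case 2
      then obtain x where "T = {x}" by (auto simp: card_1_singleton_iff)
      with that[of x x] T(1) show ?thesis by (simp add: involutive_generating_set_def)
    next
      case 3
      then obtain x y where "T = {x, y}" by (auto simp: card_2_iff)
      with that[of x y] T(1) show ?thesis by (simp add: involutive_generating_set_def)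
    qed
  qed
  have "generate G T \<subseteq> generate G {x, y}" using xy(1) by (rule mono_generate)
  moreover have "generate G {x, y} \<subseteq> carrier G"
    using xy by (intro generate_incl) (simp add: involution_def)
  ultimately have "generate G {x, y} = carrier G"
    using T(1) by (auto simp: involutive_generating_set_def)
  then show False using two[OF xy(2,3)] by simp
qed

section \<open>Generation of \<open>ESL\<close> in dimension 5\<close>

text \<open>The determinant of each generator squares to 1, and an integral domain has only the
  square roots 1 and -1 of 1.\<close>

lemma gen_carrier_ESL: "{I12, D1, FL} \<subseteq> carrier (ESL TYPE('a :: idom) 5)"
proof -
  have "det A = 1 \<or> det A = - 1" if "A \<in> carrier_mat 5 5" "A * A = 1\<^sub>m 5" for A :: "'a mat"
    using det_mult[OF that(1) that(1)] that(2) by (simp add: square_eq_1_iff)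
  then show ?thesis by (simp add: ESL_carrier_iff gen_mult_self)
qed

text \<open>The assumption says that 1 generates the ring additively, so one transvection with entry
  1 or -1 at a position yields all transvections there.\<close>

lemma generate_ESL_5:
  assumes "\<And>x :: 'a :: euclidean_ring. \<exists>k. x = of_int k"
  shows "generate (ESL TYPE('a) 5) {I12, D1, FL} = carrier (ESL TYPE('a) 5)"
proof -
  let ?G = "ESL TYPE('a) 5"
  define H where "H = generate ?G {I12, D1, FL}"
  interpret group ?G by (rule group_ESL)
  have sub: "H \<subseteq> carrier ?G" unfolding H_def by (rule generate_incl[OF gen_carrier_ESL])
  have mult: "A * B \<in> H" if "A \<in> H" "B \<in> H" for A B
    using generate.eng[of A ?G _ B] that by (simp add: H_def)
  have one: "1\<^sub>m 5 \<in> H" using generate.one[of ?G] by (simp add: H_def)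
  have word: "word_mat w \<in> H" if "set w \<subseteq> {I12, D1, FL}" for w
    using that
  proof (induction w)
    case (Cons A w)
    have "A \<in> H" unfolding H_def using Cons.prems by (intro generate.incl) auto
    with Cons mult show ?case by simp
  qed (simp add: one)
  have add: "addrow_mat 5 (a + b) i j \<in> H"
    if "addrow_mat 5 a i j \<in> H" "addrow_mat 5 b i j \<in> H" "i < 5" "j < 5" "i \<noteq> j" for a b i j
    using mult[OF that(1,2)] that by (simp add: addrow_mat_mult_same)
  have uminus: "addrow_mat 5 (- a) i j \<in> H"
    if "addrow_mat 5 a i j \<in> H" "i < 5" "j < 5" "i \<noteq> j" for a i j
  proof -
    have c: "addrow_mat 5 b i j \<in> carrier ?G" for b :: 'a
      using that by (simp add: ESL_carrier_iff det_addrow_mat)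
    have "addrow_mat 5 (- a) i j * addrow_mat 5 a i j = 1\<^sub>m 5"
      using that by (simp add: addrow_mat_mult_same addrow_mat_zero)
    then have "inv\<^bsub>?G\<^esub> (addrow_mat 5 a i j) = addrow_mat 5 (- a) i j"
      using c by (intro inv_equality) simp_all
    then show ?thesis
      using generate_m_inv_closed[OF gen_carrier_ESL, of "addrow_mat 5 a i j"] that(1) by (simp add: H_def)
  qed
  define T where "T i j \<longleftrightarrow> (\<forall>a. addrow_mat 5 a i j \<in> H)" for i j
  have T_unit: "T i j"
    if "addrow_mat 5 1 i j \<in> H \<or> addrow_mat 5 (- 1) i j \<in> H" "i < 5" "j < 5" "i \<noteq> j" for i j
    unfolding T_def
  proof
    fix a :: 'a
    have pm1: "addrow_mat 5 1 i j \<in> H" "addrow_mat 5 (- 1) i j \<in> H"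
      using that uminus[of 1 i j] uminus[of "- 1" i j] by auto
    obtain k where k: "a = of_int k" using assms by blast
    have "addrow_mat 5 (of_int k) i j \<in> H"
    proof (induction k rule: int_induct[of _ 0])
      case base
      show ?case by (simp add: addrow_mat_zero one)
    next
      case (step1 k)
      have "addrow_mat 5 (of_int k + 1) i j \<in> H"
        using step1(2) pm1(1) that(2-) by (rule add)
      then show ?case by simp
    next
      case (step2 k)
      have "addrow_mat 5 (of_int k + (- 1)) i j \<in> H"
        using step2(2) pm1(2) that(2-) by (rule add)
      then show ?case by simp
    qed
    then show "addrow_mat 5 a i j \<in> H" by (simp add: k)
  qed
  have trans: "T i k" if "T i j" "T j k" "i < 5" "j < 5" "k < 5" "i \<noteq> j" "j \<noteq> k" "i \<noteq> k" for i j k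
    unfolding T_def
  proof
    fix a
    have "addrow_mat 5 a i j * (addrow_mat 5 1 j k *
        (addrow_mat 5 (- a) i j * addrow_mat 5 (- 1) j k)) \<in> H"
      using that(1,2) unfolding T_def by (blast intro: mult)
    then show "addrow_mat 5 a i k \<in> H"
      using addrow_mat_commutator[of i 5 j k a 1] that by simp
  qed
  have w: "set transvection_word \<subseteq> {I12, D1, FL :: 'a mat}"
    by (simp add: transvection_word_def)
  have "addrow_mat 5 (- 1) 0 2 \<in> H" "addrow_mat 5 1 4 1 \<in> H" "addrow_mat 5 (- 1) 3 0 \<in> H"
    "addrow_mat 5 (- 1) 2 4 \<in> H" "addrow_mat 5 (- 1) 1 3 \<in> H"
    unfolding word_mat_transvection(1-5)[symmetric] by (rule word, use w in simp)+
  then have cyc: "T 0 2" "T 4 1" "T 3 0" "T 2 4" "T 1 3"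
    by (simp_all add: T_unit)
  have T: "T i j" if "i < 5" "j < 5" "i \<noteq> j" for i j
  proof -
    \<comment> \<open>The five known positions are the edges of the directed cycle 0, 2, 4, 1, 3.
      Commutators extend paths by one edge, so distances 2, 3 and 4 along the cycle exhaust the 20
      off-diagonal positions.\<close>
    have d2: "T 0 4" "T 2 1" "T 4 3" "T 1 0" "T 3 2"
      using cyc trans[of 0 2 4] trans[of 2 4 1] trans[of 4 1 3] trans[of 1 3 0] trans[of 3 0 2]
      by simp_all
    have d3: "T 0 1" "T 2 3" "T 4 0" "T 1 2" "T 3 4"
      using cyc d2 trans[of 0 4 1] trans[of 2 1 3] trans[of 4 3 0] trans[of 1 0 2] trans[of 3 2 4]
      by simp_all
    have d4: "T 0 3" "T 2 0" "T 4 2" "T 1 4" "T 3 1"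
      using cyc d3 trans[of 0 1 3] trans[of 2 3 0] trans[of 4 0 2] trans[of 1 2 4] trans[of 3 4 1]
      by simp_all
    have "i \<in> {0,1,2,3,4}" "j \<in> {0,1,2,3,4}" using that by auto
    then show ?thesis using cyc d2 d3 d4 \<open>i \<noteq> j\<close>
      by (elim insertE emptyE) simp_all
  qed
  have det1: "A \<in> H" if "A \<in> carrier_mat 5 5" "det A = 1" for A
    using that
  proof (induction rule: det_1_addrow_induct)
    case one
    show ?case by fact
  next
    case (addrow A a i j)
    then have "addrow_mat 5 (- a) i j * addrow a i j A \<in> H"
      using T by (intro mult) (auto simp: T_def)
    with addrow show ?case by (simp add: addrow_uminus_addrow)
  qed
  have m1: "- 1\<^sub>m 5 \<in> H"
    unfolding word_mat_transvection(6)[symmetric] by (rule word) simp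
  have "A \<in> H" if A: "A \<in> carrier ?G" for A
  proof (cases "det A = 1")
    case True
    with A det1 show ?thesis by (simp add: ESL_carrier_iff)
  next
    case False
    with A have A: "A \<in> carrier_mat 5 5" "det A = - 1" by (auto simp: ESL_carrier_iff)
    have "- A = - 1 \<cdot>\<^sub>m A" by (intro eq_matI) auto
    \<comment> \<open>The sign is \<open>(-1)^5\<close>, as the dimension is odd; \<open>A\<close>
      is then recovered from \<open>- A\<close> by the factor \<open>- 1\<^sub>m 5\<close>.\<close>
    then have "det (- A) = 1" using A by simp
    then have "- A \<in> H" using A by (intro det1) auto
    with m1 have "- 1\<^sub>m 5 * - A \<in> H" by (rule mult)
    then show ?thesis using A by simp
  qed
  with sub show ?thesis unfolding H_def by blast
qed

lemma minimal_involutive_generating_set_ESL_5: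
  assumes "\<And>x :: 'a :: euclidean_ring. \<exists>k. x = of_int k"
  shows "card {I12, D1, FL :: 'a mat} = 3 \<and>
    minimal_involutive_generating_set (ESL TYPE('a) 5) {I12, D1, FL}"
proof -
  interpret group "ESL TYPE('a) 5" by (rule group_ESL)
  have card: "card {I12, D1, FL :: 'a mat} = 3"
    using distinct_card[OF gen_distinct[where 'a = 'a]] gen_distinct[where 'a = 'a] by simp
  have inv: "involution (ESL TYPE('a) 5) x" if "x \<in> {I12, D1, FL}" for x
    using that gen_carrier_ESL[where 'a = 'a] gen_distinct[where 'a = 'a]
    by (auto simp: involution_iff gen_mult_self)
  have "\<not> (\<exists>T. involutive_generating_set (ESL TYPE('a) 5) T \<and> T \<prec> {I12, D1, FL :: 'a mat})"
    using involutive_generating_set_not_lesspoll_3[OF is_group inv[of I12] ESL_not_generated_by_two_involutions _ _ card]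
    by simp blast
  with card inv generate_ESL_5[OF assms] show ?thesis
    by (simp add: minimal_involutive_generating_set_def involutive_generating_set_def)
qed

theorem theorem2:
  shows "(card {I12, D1, FL :: int mat} = 3 \<and>
          minimal_involutive_generating_set (ESL TYPE(int) 5) {I12, D1, FL}) \<and>
         (card {I12, D1, FL :: 'p :: prime_card mod_ring mat} = 3 \<and>
          minimal_involutive_generating_set (ESL TYPE('p mod_ring) 5) {I12, D1, FL})"
proof (intro conjI[of "_ \<and> _"] minimal_involutive_generating_set_ESL_5)
  show "\<exists>k. x = of_int k" for x :: int by simp
  show "\<exists>k. x = of_int k" for x :: "'p mod_ring"
    using surj_of_nat_mod_ring[of x] by (metis of_int_of_nat_eq)
qed

end
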